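(* Let $(L,A,[\,\cdot\,,\ldots,\cdot\,],\rho)$ be an $n$-Lie--Rinehart algebra with anchor radical $\operatorname{Rad}(\rho)$. Then $$[L,\ldots,L,\operatorname{Rad}(\rho)]\subseteq\operatorname{Rad}(\rho),$$ that is, $[x_1,\ldots,x_{n-1},u]\in\operatorname{Rad}(\rho)$ for all $x_1,\ldots,x_{n-1}\in L$ and all $u\in\operatorname{Rad}(\rho)$.
   Context: $K$ is a field of characteristic zero, $A$ is a commutative associative $K$-algebra, $n\ge 2$ is an integer, and $\operatorname{Der}_K(A)$ is the $A$-module of $K$-linear derivations of $A$, with commutator bracket. An $n$-Lie algebra over $K$ is a $K$-vector space $L$ with an alternating $K$-multilinear bracket $[\,\cdot\,,\ldots,\cdot\,]:L^n\to L$ satisfying the Filippov identity $[x_1,\ldots,x_{n-1},[y_1,\ldots,y_n]]=\sum_{i=1}^n[y_1,\ldots,[x_1,\ldots,x_{n-1},y_i],\ldots,y_n]$. For $X=x_1\wedge\cdots\wedge x_{n-1}$ and $Y=y_1\wedge\cdots\wedge y_{n-1}$ (fundamental elements) put $[X,z]=[x_1,\ldots,x_{n-1},z]$ and $X\circ Y=\sum_{i=1}^{n-1}y_1\wedge\cdots\wedge[X,y_i]\wedge\cdots\wedge y_{n-1}$. An $n$-Lie--Rinehart algebra over $A$ is a quadruple $(L,A,[\,\cdot\,,\ldots,\cdot\,],\rho)$ such that: (i) $L$ is an $A$-module and an $n$-Lie algebra over $K$; (ii)--(iii) $\rho:\bigwedge_A^{n-1}L\to\operatorname{Der}_K(A)$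 (the anchor), regarded as an alternating $A$-multilinear map $\rho(x_1,\ldots,x_{n-1})=\rho(x_1\wedge\cdots\wedge x_{n-1})$, satisfies $[\rho(X),\rho(Y)]=\rho(X\circ Y)$ for all fundamental elements $X,Y$ (with chosen representatives $x_1,\ldots,x_{n-1}$ and $y_1,\ldots,y_{n-1}$); (iv) $[x_1,\ldots,x_{n-1},ay]=a[x_1,\ldots,x_{n-1},y]+\rho(x_1,\ldots,x_{n-1})(a)\,y$ for all $x_j,y\in L$, $a\in A$. The anchor radical is $\operatorname{Rad}(\rho)=\{u\in L:\rho(u,x_2,\ldots,x_{n-1})=0\ \text{for all }x_2,\ldots,x_{n-1}\in L\}$. *)

theory Defs
  imports "HOL-Algebra.Module" "HOL-Library.NList"
begin

text \<open>
  An \<open>m\<close>-ary map on a carrier is a function on lists, of which only the values on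
  \<open>nlists m (carrier M)\<close> matter; \<open>xs[i := x]\<close> varies the \<open>i\<close>-th argument (counting from 0).
\<close>

definition alternating_multilinear ::
  "('r, 's) ring_scheme \<Rightarrow> ('r, 'b, 't) module_scheme \<Rightarrow> ('r, 'c, 'u) module_scheme \<Rightarrow>
    nat \<Rightarrow> ('b list \<Rightarrow> 'c) \<Rightarrow> bool"
where
  "alternating_multilinear R M N m f \<longleftrightarrow>
     f \<in> nlists m (carrier M) \<rightarrow> carrier N \<and>
     (\<forall>xs \<in> nlists m (carrier M). \<forall>i < m. \<forall>x \<in> carrier M. \<forall>y \<in> carrier M.
        f (xs[i := x \<oplus>\<^bsub>M\<^esub> y]) = f (xs[i := x]) \<oplus>\<^bsub>N\<^esub> f (xs[i := y])) \<and>
     (\<forall>xs \<in> nlists m (carrier M). \<forall>i < m. \<forall>r \<in> carrier R. \<forall>x \<in> carrier M.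
        f (xs[i := r \<odot>\<^bsub>M\<^esub> x]) = r \<odot>\<^bsub>N\<^esub> f (xs[i := x])) \<and>
     (\<forall>xs \<in> nlists m (carrier M). \<not> distinct xs \<longrightarrow> f xs = \<zero>\<^bsub>N\<^esub>)"

text \<open>
  Derivations are taken extensional (undefined outside \<open>carrier A\<close>), so that equality of
  derivations is equality of functions.  The fields \<open>mult\<close> and \<open>one\<close> of the module record are
  never used.
\<close>

definition Der ::
  "('k, 's) ring_scheme \<Rightarrow> ('k, 'a, 't) module_scheme \<Rightarrow> ('a, 'a \<Rightarrow> 'a) module"
where
  "Der K A =
    \<lparr>carrier = {D \<in> carrier A \<rightarrow>\<^sub>E carrier A.
       (\<forall>a \<in> carrier A. \<forall>b \<in> carrier A. D (a \<oplus>\<^bsub>A\<^esub> b) = D a \<oplus>\<^bsub>A\<^esub> D b) \<and>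
       (\<forall>k \<in> carrier K. \<forall>a \<in> carrier A. D (k \<odot>\<^bsub>A\<^esub> a) = k \<odot>\<^bsub>A\<^esub> D a) \<and>
       (\<forall>a \<in> carrier A. \<forall>b \<in> carrier A.
          D (a \<otimes>\<^bsub>A\<^esub> b) = (D a \<otimes>\<^bsub>A\<^esub> b) \<oplus>\<^bsub>A\<^esub> (a \<otimes>\<^bsub>A\<^esub> D b))},
     mult = undefined,
     one = undefined,
     zero = (\<lambda>a \<in> carrier A. \<zero>\<^bsub>A\<^esub>),
     add = (\<lambda>D E. \<lambda>a \<in> carrier A. D a \<oplus>\<^bsub>A\<^esub> E a),
     smult = (\<lambda>b D. \<lambda>a \<in> carrier A. b \<otimes>\<^bsub>A\<^esub> D a)\<rparr>"

definition commutator ::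
  "('k, 'a, 't) module_scheme \<Rightarrow> ('a \<Rightarrow> 'a) \<Rightarrow> ('a \<Rightarrow> 'a) \<Rightarrow> ('a \<Rightarrow> 'a)"
where
  "commutator A D E = (\<lambda>a \<in> carrier A. D (E a) \<ominus>\<^bsub>A\<^esub> E (D a))"

text \<open>The \<open>K\<close>-vector space underlying an \<open>A\<close>-module, along \<open>k \<mapsto> k \<odot> 1\<close>.\<close>

definition restrict_scalars ::
  "('k, 'a, 't) module_scheme \<Rightarrow> ('a, 'l, 'u) module_scheme \<Rightarrow> ('k, 'l) module"
where
  "restrict_scalars A L =
    \<lparr>carrier = carrier L, mult = mult L, one = one L, zero = \<zero>\<^bsub>L\<^esub>, add = add L,
     smult = (\<lambda>k x. (k \<odot>\<^bsub>A\<^esub> \<one>\<^bsub>A\<^esub>) \<odot>\<^bsub>L\<^esub> x)\<rparr>"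

locale n_Lie_algebra = K?: field K + V?: module K V
  for K (structure) and V (structure) +
  fixes n :: nat and br :: "'c list \<Rightarrow> 'c"
  assumes br_alternating: "alternating_multilinear K V V n br"
    and Filippov: "\<lbrakk>xs \<in> nlists (n - 1) (carrier V); ys \<in> nlists n (carrier V)\<rbrakk> \<Longrightarrow>
      br (xs @ [br ys]) = (\<Oplus>\<^bsub>V\<^esub>i \<in> {..<n}. br (ys[i := br (xs @ [ys ! i])]))"

text \<open>
  The anchor is given as an alternating \<open>A\<close>-multilinear map \<open>\<rho>\<close> on \<open>n - 1\<close> arguments.
  For fundamental elements with representatives \<open>xs\<close> and \<open>ys\<close>, \<open>X \<circ> Y\<close> is the sum over \<open>i\<close> of
  the fundamental elements represented by \<open>ys[i := [X, y\<^sub>i]]\<close>, so by additivity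
  \<open>\<rho> (X \<circ> Y)\<close> is the sum of the values of \<open>\<rho>\<close> on these representatives.
\<close>

locale n_Lie_Rinehart_algebra =
  A?: algebra K A + L?: module A L + n_Lie_algebra K "restrict_scalars A L" n br
  for K (structure) and A (structure) and L (structure)
    and n :: nat and br :: "'l list \<Rightarrow> 'l" +
  fixes \<rho> :: "'l list \<Rightarrow> 'a \<Rightarrow> 'a"
  assumes anchor_alternating: "alternating_multilinear A L (Der K A) (n - 1) \<rho>"
    and anchor_bracket:
      "\<lbrakk>xs \<in> nlists (n - 1) (carrier L); ys \<in> nlists (n - 1) (carrier L)\<rbrakk> \<Longrightarrow>
        commutator A (\<rho> xs) (\<rho> ys) =
          (\<Oplus>\<^bsub>Der K A\<^esub>i \<in> {..<n - 1}. \<rho> (ys[i := br (xs @ [ys ! i])]))"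
    and Leibniz:
      "\<lbrakk>xs \<in> nlists (n - 1) (carrier L); y \<in> carrier L; a \<in> carrier A\<rbrakk> \<Longrightarrow>
        br (xs @ [a \<odot>\<^bsub>L\<^esub> y]) = (a \<odot>\<^bsub>L\<^esub> br (xs @ [y])) \<oplus>\<^bsub>L\<^esub> (\<rho> xs a \<odot>\<^bsub>L\<^esub> y)"

definition anchor_radical ::
  "('k, 's) ring_scheme \<Rightarrow> ('k, 'a, 't) module_scheme \<Rightarrow> ('a, 'l, 'u) module_scheme \<Rightarrow>
    nat \<Rightarrow> ('l list \<Rightarrow> 'a \<Rightarrow> 'a) \<Rightarrow> 'l set"
where
  "anchor_radical K A L n \<rho> =
    {u \<in> carrier L. \<forall>xs \<in> nlists (n - 2) (carrier L). \<rho> (u # xs) = \<zero>\<^bsub>Der K A\<^esub>}"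

end

theory Submission
  imports Defs
begin

text \<open>Makes the laws of finite sums available for the sum in \<open>anchor_bracket\<close>.
  Derivations are restricted functions, so the neutral law for zero rests on extensionality.\<close>

lemma (in algebra) abelian_monoid_Der: "abelian_monoid (Der R M)"
proof (rule abelian_monoidI)
  fix D E assume D: "D \<in> carrier (Der R M)" and E: "E \<in> carrier (Der R M)"
  then have [simp]: "\<And>a. a \<in> carrier M \<Longrightarrow> D a \<in> carrier M" "\<And>a. a \<in> carrier M \<Longrightarrow> E a \<in> carrier M"
    by (auto simp: Der_def PiE_iff)
  from D E show "D \<oplus>\<^bsub>Der R M\<^esub> E \<in> carrier (Der R M)"
    by (auto simp: Der_def M.a_ac l_distr r_distr smult_r_distr)
  show "D \<oplus>\<^bsub>Der R M\<^esub> E = E \<oplus>\<^bsub>Der R M\<^esub> D"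
    by (auto simp: Der_def M.a_comm intro!: restrict_ext)
next
  show "\<zero>\<^bsub>Der R M\<^esub> \<in> carrier (Der R M)"
    by (auto simp: Der_def smult_r_null)
next
  fix D E F assume "D \<in> carrier (Der R M)" "E \<in> carrier (Der R M)" "F \<in> carrier (Der R M)"
  then show "D \<oplus>\<^bsub>Der R M\<^esub> E \<oplus>\<^bsub>Der R M\<^esub> F = D \<oplus>\<^bsub>Der R M\<^esub> (E \<oplus>\<^bsub>Der R M\<^esub> F)"
    by (auto simp: Der_def PiE_iff M.a_assoc intro!: restrict_ext)
next
  fix D assume "D \<in> carrier (Der R M)"
  then show "\<zero>\<^bsub>Der R M\<^esub> \<oplus>\<^bsub>Der R M\<^esub> D = D"
    by (auto simp: Der_def PiE_iff intro!: extensionalityI[where A = "carrier M"])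
qed

text \<open>Both terms vanish: \<open>D\<close> maps zero to zero by additivity, and the zero
  derivation kills every \<open>D a\<close>.\<close>

lemma (in algebra) commutator_Der_zero:
  assumes "D \<in> carrier (Der R M)"
  shows "commutator M D \<zero>\<^bsub>Der R M\<^esub> = \<zero>\<^bsub>Der R M\<^esub>"
proof -
  have Da: "D a \<in> carrier M" if "a \<in> carrier M" for a
    using assms that by (auto simp: Der_def)
  have "D (\<zero>\<^bsub>M\<^esub> \<oplus>\<^bsub>M\<^esub> \<zero>\<^bsub>M\<^esub>) = D \<zero>\<^bsub>M\<^esub> \<oplus>\<^bsub>M\<^esub> D \<zero>\<^bsub>M\<^esub>"
    using assms unfolding Der_def by (simp del: M.r_zero M.l_zero)
  then have "D \<zero>\<^bsub>M\<^esub> = \<zero>\<^bsub>M\<^esub>"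
    using Da by (simp add: M.add.l_cancel_one)
  with Da show ?thesis
    by (auto simp: commutator_def Der_def M.minus_eq intro!: restrict_ext)
qed

lemma (in n_Lie_Rinehart_algebra) bracket_closed:
  assumes "ys \<in> nlists n (carrier L)"
  shows "br ys \<in> carrier L"
  using br_alternating assms
  by (auto simp: alternating_multilinear_def restrict_scalars_def)

lemma (in n_Lie_Rinehart_algebra) anchor_closed:
  assumes "xs \<in> nlists (n - 1) (carrier L)"
  shows "\<rho> xs \<in> carrier (Der K A)"
  using anchor_alternating assms by (auto simp: alternating_multilinear_def)

text \<open>
  Apply the anchor to \<open>X \<circ> Y\<close> with \<open>Y = u \<and> z\<^sub>2 \<and> \<dots> \<and> z\<^bsub>n-1\<^esub>\<close>.  Since \<open>\<rho> Y = 0\<close>, the commutator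
  \<open>[\<rho> X, \<rho> Y]\<close> vanishes; in the expansion of \<open>\<rho> (X \<circ> Y)\<close> every summand that still contains \<open>u\<close>
  vanishes as well, so the only remaining one, \<open>\<rho> ([X, u] \<and> z\<^sub>2 \<and> \<dots> \<and> z\<^bsub>n-1\<^esub>)\<close>, is zero.
\<close>

theorem proposition3p4:
  fixes K :: "('k, 's) ring_scheme"
    and A :: "('k, 'a, 't) module_scheme"
    and L :: "('a, 'l, 'u) module_scheme"
    and n :: nat
    and br :: "'l list \<Rightarrow> 'l"
    and \<rho> :: "'l list \<Rightarrow> 'a \<Rightarrow> 'a"
  assumes char_zero: "\<And>m::nat. m > 0 \<Longrightarrow> [m] \<cdot>\<^bsub>K\<^esub> \<one>\<^bsub>K\<^esub> \<noteq> \<zero>\<^bsub>K\<^esub>"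
    and "n \<ge> 2"
    and "n_Lie_Rinehart_algebra K A L n br \<rho>"
  shows "\<forall>xs \<in> nlists (n - 1) (carrier L). \<forall>u \<in> anchor_radical K A L n \<rho>.
           br (xs @ [u]) \<in> anchor_radical K A L n \<rho>"
proof (intro ballI)
  fix xs u
  assume xs: "xs \<in> nlists (n - 1) (carrier L)" and u: "u \<in> anchor_radical K A L n \<rho>"
  interpret n_Lie_Rinehart_algebra K A L n br \<rho> by fact
  interpret D: abelian_monoid "Der K A" by (rule A.abelian_monoid_Der)
  \<comment> \<open>With \<open>m\<close> = n - 2, the tail of Y has length \<open>m\<close> and Y
    itself length \<open>Suc m\<close>, free of truncated subtraction.\<close>
  obtain m where n: "n = Suc (Suc m)"
    using \<open>n \<ge> 2\<close> by (metis add_2_eq_Suc le_Suc_ex)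
  have uL: "u \<in> carrier L"
    and \<rho>_u: "\<And>zs. zs \<in> nlists m (carrier L) \<Longrightarrow> \<rho> (u # zs) = \<zero>\<^bsub>Der K A\<^esub>"
    using u by (auto simp: anchor_radical_def n)
  have br_xs: "br (xs @ [y]) \<in> carrier L" if "y \<in> carrier L" for y
    using nlists_appendI[OF xs, of "[y]" 1] that by (intro bracket_closed) (simp add: n)
  have "\<rho> (br (xs @ [u]) # zs) = \<zero>\<^bsub>Der K A\<^esub>" if zs: "zs \<in> nlists m (carrier L)" for zs
  proof -
    \<comment> \<open>The summands of \<rho>(X \<circ> Y) for Y = \<open>u # zs\<close>; index 0 is
      the one where \<open>u\<close> itself is replaced by [X, u].\<close>
    define g where "g i = \<rho> ((u # zs)[i := br (xs @ [(u # zs) ! i])])" for i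
    have g0: "g 0 = \<rho> (br (xs @ [u]) # zs)"
      by (simp add: g_def)
    have g0_closed: "g 0 \<in> carrier (Der K A)"
      unfolding g0 using zs br_xs[OF uL] by (intro anchor_closed) (simp add: n)
    \<comment> \<open>The replacement happens inside \<open>zs\<close>, so \<open>u\<close> stays at
      the head, the slot in which \<open>anchor_radical\<close> tests it.\<close>
    have g_Suc: "g (Suc i) = \<zero>\<^bsub>Der K A\<^esub>" if "i < m" for i
    proof -
      have "zs ! i \<in> carrier L"
        using zs that by (rule nlistsE_nth_in)
      then have "zs[i := br (xs @ [zs ! i])] \<in> nlists m (carrier L)"
        using zs br_xs by simp
      then show ?thesis
        by (simp add: g_def \<rho>_u)
    qed
    have ys: "u # zs \<in> nlists (n - 1) (carrier L)"
      using uL zs by (simp add: n)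
    have "\<zero>\<^bsub>Der K A\<^esub> = commutator A (\<rho> xs) (\<rho> (u # zs))"
      using A.commutator_Der_zero anchor_closed xs \<rho>_u[OF zs] by simp
    also have "\<dots> = (\<Oplus>\<^bsub>Der K A\<^esub>i \<in> {..<n - 1}. g i)"
      using anchor_bracket[OF xs ys] by (simp add: g_def)
    \<comment> \<open>Splits off the index of \<open>u\<close>; the other indices are exactly the
      successors covered by \<open>g_Suc\<close>.\<close>
    also have "{..<n - 1} = insert 0 (Suc ` {..<m})"
      by (simp add: n lessThan_Suc_eq_insert_0)
    also have "(\<Oplus>\<^bsub>Der K A\<^esub>i \<in> insert 0 (Suc ` {..<m}). g i) =
        g 0 \<oplus>\<^bsub>Der K A\<^esub> (\<Oplus>\<^bsub>Der K A\<^esub>i \<in> Suc ` {..<m}. g i)"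
      using g0_closed g_Suc by (intro D.finsum_insert) auto
    also have "(\<Oplus>\<^bsub>Der K A\<^esub>i \<in> Suc ` {..<m}. g i) = \<zero>\<^bsub>Der K A\<^esub>"
      using g_Suc by (intro D.add.finprod_one_eqI) auto
    \<comment> \<open>The chain now reads zero = \<open>g 0\<close> + zero, and \<open>g 0\<close>
      is the value sought.\<close>
    finally show ?thesis
      using g0 g0_closed by simp
  qed
  with br_xs[OF uL] show "br (xs @ [u]) \<in> anchor_radical K A L n \<rho>"
    by (simp add: anchor_radical_def n)
qed

end
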